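(* For every real $x\neq 0$, the function $\alpha\mapsto E_\alpha(\Gamma(1+\alpha)x)$ is decreasing on $(0,1)$.
   Context: For $\alpha>0$, $E_\alpha$ denotes the Mittag-Leffler function $E_\alpha(z)=\sum_{n\ge 0} \frac{z^n}{\Gamma(1+n\alpha)}$, where $\Gamma$ is the Gamma function. *)

theory Defs
  imports "HOL-Analysis.Analysis"
begin

definition mittag_leffler :: "real \<Rightarrow> real \<Rightarrow> real" where
  "mittag_leffler \<alpha> z = (\<Sum>n. z ^ n / Gamma (1 + real n * \<alpha>))"

end

theory Submission
  imports Defs "HOL-Probability.Probability" "HOL-Real_Asymp.Real_Asymp"
begin

text \<open>
  For rational \<open>0 < b < a < 1\<close>, Gauss's multiplication formula writes
  \<open>Gamma (1 + a u) / Gamma (1 + b u)\<close> as a product of moment functions of beta and gamma laws, so it is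
  \<open>E (Y powr u)\<close> for some positive random variable \<open>Y\<close>. Likewise \<open>n! / Gamma (1 + n a)\<close> is the
  \<open>n\<close>-th moment of a positive law, so \<open>F = mittag_leffler a\<close> is a moment generating function and
  hence strictly convex. Summing the series, \<open>mittag_leffler b t = E (F (t Y))\<close>; for
  \<open>t = Gamma (1 + b) x\<close> the mean of \<open>t Y\<close> is \<open>Gamma (1 + a) x\<close>, and Jensen's inequality for the
  non-constant \<open>Y\<close> gives the strict inequality. Irrational parameters follow because the function is
  continuous, the coefficients \<open>Gamma (1 + a) ^ n / Gamma (1 + n a)\<close> being decreasing in \<open>a\<close>.
\<close>

subsection \<open>The Gamma function\<close>

lemma Gamma_real_plus1: "x > 0 \<Longrightarrow> Gamma (x + 1 :: real) = x * Gamma x"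
  by (rule Gamma_plus1) (auto elim!: nonpos_Ints_cases')

text \<open>Gauss's formula, normalised so that both sides are 1 at \<open>u = 0\<close>: each
  factor is then a quotient with the shape of a moment function of a gamma law. It follows from the
  uniqueness of Gamma as a log-convex solution of its functional equation (Bohr-Mollerup). Dividing
  by \<open>C\<close> fixes the value at 1, so the closed form of that constant never
  appears.\<close>

lemma Gamma_multiplication:
  fixes u :: real
  assumes "p > 0" "u \<ge> 0"
  shows "Gamma (1 + real p * u) = real p powr (real p * u) *
           (\<Prod>j<p. Gamma (u + (1 + real j) / real p) / Gamma ((1 + real j) / real p))"
proof -
  define C where "C = (\<Prod>j<p. Gamma ((1 + real j) / real p))"
  define G where "G = (\<lambda>x. real p powr (x - 1) * (\<Prod>j<p. Gamma ((x + real j) / real p)) / C)"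
  have "C > 0" unfolding C_def using assms by (intro prod_pos) auto
  have pos: "Gamma ((x + real j) / real p) > 0" if "x > 0" for x j
    using assms that by (intro Gamma_real_pos divide_pos_pos) auto
  have Gpos: "G x > 0" if "x > 0" for x
    unfolding G_def using assms that pos \<open>C > 0\<close> by (intro divide_pos_pos mult_pos_pos prod_pos) auto
  have "G x = Gamma x" if "x > 0" for x
  proof (rule Gamma_pos_real_unique[OF _ _ Gpos _ that])
    show "G 1 = 1" using \<open>C > 0\<close> assms by (simp add: G_def flip: C_def)
  next
    fix x :: real assume x: "x > 0"
    \<comment> \<open>Raising \<open>x\<close> by 1 shifts the index \<open>j\<close> by 1, so the
      product only trades its factor at \<open>j = 0\<close> for one at \<open>j = p\<close>, which
      is \<open>Gamma (x / real p + 1)\<close>.\<close>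
    have "(\<Prod>j<p. Gamma ((x + 1 + real j) / real p)) * Gamma (x / real p)
        = (\<Prod>j<Suc p. Gamma ((x + real j) / real p))"
      by (subst prod.lessThan_Suc_shift) (simp add: algebra_simps)
    also have "\<dots> = (\<Prod>j<p. Gamma ((x + real j) / real p)) * Gamma (x / real p + 1)"
      using assms by (simp add: add_divide_distrib)
    also have "Gamma (x / real p + 1) = x / real p * Gamma (x / real p)"
      using x assms by (intro Gamma_real_plus1) auto
    finally have "(\<Prod>j<p. Gamma ((x + 1 + real j) / real p)) * Gamma (x / real p)
        = (\<Prod>j<p. Gamma ((x + real j) / real p)) * (x / real p * Gamma (x / real p))" .
    moreover have "Gamma (x / real p) \<noteq> 0"
      using x assms by (intro less_imp_neq[THEN not_sym] Gamma_real_pos) auto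
    ultimately have *: "(\<Prod>j<p. Gamma ((x + 1 + real j) / real p))
        = (\<Prod>j<p. Gamma ((x + real j) / real p)) * (x / real p)"
      by (metis mult.assoc mult_right_cancel)
    have "real p powr (x + 1 - 1) = real p powr (x - 1) * real p"
      using assms powr_add[of "real p" "x - 1" 1] by simp
    then show "G (x + 1) = x * G x"
      unfolding G_def * using assms by simp
  next
    \<comment> \<open>\<open>h\<close> is the logarithm of \<open>G\<close> written out on the
      positive reals; its derivative is a constant plus a sum of increasing Digamma terms, whence
      the convexity.\<close>
    define h where "h = (\<lambda>x. (x - 1) * ln (real p) + (\<Sum>j<p. ln_Gamma ((x + real j) / real p)) - ln C)"
    have ln_G: "h x = (ln \<circ> G) x" if "x \<in> {0<..}" for x
      using assms that \<open>C > 0\<close> pos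
      by (simp add: G_def h_def ln_div ln_mult ln_powr ln_prod prod_pos less_imp_neq[THEN not_sym] ln_Gamma_real_pos)
    show "convex_on {0<..} (ln \<circ> G)"
    proof (rule convex_on_realI[where f' = "\<lambda>x. ln (real p) + (\<Sum>j<p. Digamma ((x + real j) / real p) / real p)"])
      fix x :: real assume x: "x \<in> {0<..}"
      have "(h has_real_derivative ln (real p) + (\<Sum>j<p. Digamma ((x + real j) / real p) / real p)) (at x)"
        using assms x unfolding h_def by (auto intro!: derivative_eq_intros sum.cong divide_pos_pos)
      then show "((ln \<circ> G) has_real_derivative ln (real p) + (\<Sum>j<p. Digamma ((x + real j) / real p) / real p)) (at x)"
        by (rule has_field_derivative_transform_within_open[OF _ open_greaterThan x ln_G])
    next
      fix x y :: real assume "x \<in> {0<..}" "y \<in> {0<..}" "x \<le> y"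
      then show "ln (real p) + (\<Sum>j<p. Digamma ((x + real j) / real p) / real p)
        \<le> ln (real p) + (\<Sum>j<p. Digamma ((y + real j) / real p) / real p)"
        using assms by (intro add_left_mono sum_mono divide_right_mono Digamma_real_mono divide_pos_pos)
          (auto simp: divide_right_mono)
    qed auto
  qed
  moreover have "1 + real p * u > 0" using assms by (intro add_pos_nonneg) auto
  ultimately have "G (1 + real p * u) = Gamma (1 + real p * u)" by blast
  moreover have "(1 + real p * u + real j) / real p = u + (1 + real j) / real p" for j
    using assms by (simp add: field_simps)
  ultimately show ?thesis by (simp add: G_def C_def prod_dividef)
qed

text \<open>The logarithmic derivative is
  \<open>n * (Digamma (1 + x) - Digamma (1 + n * x))\<close>, negative for \<open>x > 0\<close> as
  Digamma is strictly increasing. The case \<open>n = 2\<close> later shows that the mixing variable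
  is not constant; the weak form for all \<open>n\<close> gives the domination behind
  continuity.\<close>

lemma Gamma_ratio_less:
  fixes a b :: real
  assumes "n \<ge> 2" "0 \<le> a" "a < b"
  shows "Gamma (1 + b) ^ n / Gamma (1 + real n * b) < Gamma (1 + a) ^ n / Gamma (1 + real n * a)"
proof -
  define h where "h = (\<lambda>x. real n * ln_Gamma (1 + x) - ln_Gamma (1 + real n * x))"
  have eq: "Gamma (1 + x) ^ n / Gamma (1 + real n * x) = exp (h x)" if "x \<ge> 0" for x
    using that by (simp add: h_def exp_diff exp_of_nat_mult Gamma_real_pos_exp add_pos_nonneg)
  have "h b < h a"
  \<comment> \<open>The derivative vanishes at 0, which \<open>a\<close> may equal, so its sign is
    used only on the open interval.\<close>
  proof (rule DERIV_neg_imp_decreasing_open[OF \<open>a < b\<close>])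
    fix x assume x: "a < x" "x < b"
    have "1 + x < 1 + real n * x" using x assms by simp
    then have "Digamma (1 + x) < Digamma (1 + real n * x)"
      using x assms by (intro Digamma_real_strict_mono) auto
    then have "real n * (Digamma (1 + x) - Digamma (1 + real n * x)) < 0"
      using assms by (simp add: mult_less_0_iff)
    moreover have "(h has_real_derivative real n * (Digamma (1 + x) - Digamma (1 + real n * x))) (at x)"
      unfolding h_def using x assms
      by (auto intro!: derivative_eq_intros simp: algebra_simps add_pos_nonneg)
    ultimately show "\<exists>y. (h has_real_derivative y) (at x) \<and> y < 0" by blast
  next
    have "(h has_real_derivative real n * (Digamma (1 + x) - Digamma (1 + real n * x))) (at x)"
      if "x \<ge> 0" for x
      unfolding h_def using that assms
      by (auto intro!: derivative_eq_intros simp: algebra_simps add_pos_nonneg)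
    then show "continuous_on {a..b} h"
      using assms by (meson atLeastAtMost_iff continuous_at_imp_continuous_on DERIV_isCont order_trans)
  qed
  then show ?thesis using eq assms by simp
qed

lemma Gamma_ratio_le:
  fixes a b :: real
  assumes "0 \<le> a" "a \<le> b"
  shows "Gamma (1 + b) ^ n / Gamma (1 + real n * b) \<le> Gamma (1 + a) ^ n / Gamma (1 + real n * a)"
proof -
  consider "a = b" | "n = 0" | "n = 1" | "n \<ge> 2" "a < b" using assms by linarith
  then show ?thesis
  proof cases
    case 3
    then show ?thesis using assms Gamma_real_pos[of "1 + a"] Gamma_real_pos[of "1 + b"]
      by (simp del: Gamma_real_pos)
  next
    case 4
    then show ?thesis using Gamma_ratio_less[of n a b] assms by simp
  qed auto
qed

text \<open>Log-convexity: the slope of \<open>ln_Gamma\<close> over \<open>[x, x + s]\<close> is at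
  least its slope over \<open>[x - 1, x]\<close>, which is \<open>ln (x - 1)\<close> by the
  functional equation.\<close>

lemma Gamma_shift_lower_bound:
  fixes x s :: real
  assumes "x > 1" "s > 0"
  shows "(x - 1) powr s * Gamma x \<le> Gamma (x + s)"
proof -
  have "\<exists>z>x. z < x + s \<and> ln_Gamma (x + s) - ln_Gamma x = (x + s - x) * Digamma z"
    using assms by (intro MVT2) (auto intro!: derivative_eq_intros)
  then obtain z where z: "z > x" "ln_Gamma (x + s) - ln_Gamma x = s * Digamma z" by auto
  have "\<exists>w>x-1. w < x \<and> ln_Gamma x - ln_Gamma (x - 1) = (x - (x - 1)) * Digamma w"
    using assms by (intro MVT2) (auto intro!: derivative_eq_intros)
  then obtain w where w: "w > x - 1" "w < x" "ln_Gamma x - ln_Gamma (x - 1) = Digamma w" by auto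
  have "Gamma (x - 1 + 1) = (x - 1) * Gamma (x - 1)"
    using assms by (intro Gamma_real_plus1) auto
  moreover have "Gamma (x - 1) \<noteq> 0"
    using assms Gamma_real_pos[of "x - 1"] by linarith
  ultimately have "ln_Gamma x = ln (x - 1) + ln_Gamma (x - 1)"
    using assms by (simp add: ln_Gamma_real_pos ln_mult)
  then have "ln (x - 1) \<le> Digamma z"
    using w z assms Digamma_real_mono[of w z] by simp
  then have "s * ln (x - 1) + ln_Gamma x \<le> ln_Gamma (x + s)"
    using z mult_left_mono[of "ln (x - 1)" "Digamma z" s] assms(2) by linarith
  then have "exp (s * ln (x - 1) + ln_Gamma x) \<le> exp (ln_Gamma (x + s))" by simp
  then show ?thesis using assms by (simp add: exp_add powr_def Gamma_real_pos_exp)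
qed

subsection \<open>The Mittag-Leffler series\<close>

text \<open>Ratio test: consecutive Gamma values grow by a factor of at least
  \<open>(n * a) powr a\<close>, which tends to infinity and so eventually exceeds twice the modulus
  of \<open>z\<close>.\<close>

lemma summable_mittag_leffler:
  fixes a z :: real
  assumes "a > 0"
  shows "summable (\<lambda>n. z ^ n / Gamma (1 + real n * a))"
proof -
  have "filterlim (\<lambda>n. (real n * a) powr a) at_top sequentially"
    using assms by real_asymp
  then have "eventually (\<lambda>n. (real n * a) powr a \<ge> 2 * \<bar>z\<bar>) sequentially"
    by (simp add: filterlim_at_top)
  \<comment> \<open>Positive \<open>n\<close> makes \<open>1 + n * a > 1\<close>, as the growth
    bound requires.\<close>
  with eventually_gt_at_top[of 0]
  have "eventually (\<lambda>n. n > 0 \<and> (real n * a) powr a \<ge> 2 * \<bar>z\<bar>) sequentially"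
    by (rule eventually_conj)
  then obtain N where N: "\<And>n. n \<ge> N \<Longrightarrow> n > 0 \<and> (real n * a) powr a \<ge> 2 * \<bar>z\<bar>"
    by (auto simp: eventually_at_top_linorder)
  show ?thesis
  proof (rule summable_ratio_test[of "1/2" N])
    fix n assume "n \<ge> N"
    then have n: "n > 0" "(real n * a) powr a \<ge> 2 * \<bar>z\<bar>" using N by auto
    define G where "G = Gamma (1 + real n * a)"
    define H where "H = Gamma (1 + real (Suc n) * a)"
    have G: "G > 0" "H > 0" unfolding G_def H_def using assms by (auto intro!: Gamma_real_pos add_pos_nonneg)
    have "2 * \<bar>z\<bar> * G \<le> (real n * a) powr a * G" using n G by (intro mult_right_mono) auto
    also have "\<dots> \<le> H"
      using Gamma_shift_lower_bound[of "1 + real n * a" a] n assms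
      by (simp add: G_def H_def algebra_simps)
    finally have "2 * \<bar>z\<bar> * G * \<bar>z\<bar> ^ n \<le> H * \<bar>z\<bar> ^ n" by (intro mult_right_mono) auto
    then show "norm (z ^ Suc n / Gamma (1 + real (Suc n) * a)) \<le> 1/2 * norm (z ^ n / Gamma (1 + real n * a))"
      unfolding G_def[symmetric] H_def[symmetric] using G
      by (simp add: field_simps power_abs abs_mult)
  qed simp
qed

section \<open>Continuity in the parameter and reduction to rational parameters\<close>

lemma continuous_on_mittag_leffler_Gamma:
  fixes x :: real
  shows "continuous_on {0<..<1} (\<lambda>a. mittag_leffler a (Gamma (1 + a) * x))"
proof -
  \<comment> \<open>The coefficients decrease in the parameter, so on this interval the series at
    \<open>c\<close> is a convergent majorant. The intervals with \<open>c > 0\<close> are open and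
    cover the unit interval.\<close>
  have "continuous_on {c<..<1} (\<lambda>a. mittag_leffler a (Gamma (1 + a) * x))" if "c > 0" for c
    unfolding mittag_leffler_def
  proof (rule uniform_limit_theorem)
    show "uniform_limit {c<..<1} (\<lambda>n a. \<Sum>i<n. (Gamma (1 + a) * x) ^ i / Gamma (1 + real i * a))
       (\<lambda>a. \<Sum>i. (Gamma (1 + a) * x) ^ i / Gamma (1 + real i * a)) sequentially"
    proof (rule Weierstrass_m_test)
      fix n a assume a: "a \<in> {c<..<1}"
      have "norm ((Gamma (1 + a) * x) ^ n / Gamma (1 + real n * a))
          = (Gamma (1 + a)) ^ n / Gamma (1 + real n * a) * \<bar>x\<bar> ^ n"
        using a that Gamma_real_pos[of "1 + a"] Gamma_real_pos[of "1 + real n * a"]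
        by (simp add: power_mult_distrib power_abs abs_mult abs_of_pos add_pos_nonneg)
      also have "\<dots> \<le> (Gamma (1 + c)) ^ n / Gamma (1 + real n * c) * \<bar>x\<bar> ^ n"
        using a that by (intro mult_right_mono Gamma_ratio_le) auto
      finally show "norm ((Gamma (1 + a) * x) ^ n / Gamma (1 + real n * a))
        \<le> (Gamma (1 + c) * \<bar>x\<bar>) ^ n / Gamma (1 + real n * c)" by (simp add: power_mult_distrib)
    qed (use summable_mittag_leffler that in auto)
  next
    show "\<forall>\<^sub>F n in sequentially. continuous_on {c<..<1}
       (\<lambda>a. \<Sum>i<n. (Gamma (1 + a) * x) ^ i / Gamma (1 + real i * a))"
    proof (intro always_eventually allI continuous_on_sum continuous_on_divide continuous_on_power
        continuous_on_mult continuous_on_const ballI)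
      show "continuous_on {c<..<1} (\<lambda>a. Gamma (1 + real i * a))" for i
        using that by (intro continuous_on_compose2[OF continuous_on_Gamma[of "{0<..}"]])
          (auto intro!: continuous_intros add_pos_nonneg elim!: nonpos_Ints_cases')
      from this[of 1] show "continuous_on {c<..<1} (\<lambda>a. Gamma (1 + a))" by simp
      show "Gamma (1 + real i * a) \<noteq> 0" if "a \<in> {c<..<1}" for i a
        using that \<open>c > 0\<close> by (intro less_imp_neq[THEN not_sym] Gamma_real_pos add_pos_nonneg) auto
    qed
  qed auto
  then have "continuous_on (\<Union>c\<in>{0<..}. {c<..<1}) (\<lambda>a. mittag_leffler a (Gamma (1 + a) * x))"
    by (intro continuous_on_open_UN) auto
  also have "(\<Union>c\<in>{0<..}. {c<..<1}) = {0<..<1::real}"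
    by (auto simp: Bex_def dest: dense)
  finally show ?thesis .
qed

text \<open>Continuity alone would lose strictness in the limit. Two rationals \<open>r < s\<close>
  between the arguments keep it: the strict step is taken from \<open>r\<close> to \<open>s\<close>,
  and only weak inequalities are needed towards the real endpoints.\<close>

lemma strict_antimono_on_from_Rats:
  fixes f :: "real \<Rightarrow> real"
  assumes cont: "continuous_on {0<..<1} f"
    and rat: "\<And>a b. a \<in> \<rat> \<Longrightarrow> b \<in> \<rat> \<Longrightarrow> 0 < b \<Longrightarrow> b < a \<Longrightarrow> a < 1 \<Longrightarrow> f a < f b"
  shows "strict_antimono_on {0<..<1} f"
proof (rule monotone_onI)
  have cont_at: "isCont f a" if "a \<in> {0<..<1}" for a
    using cont that by (simp add: continuous_on_eq_continuous_at)
  have left: "f r \<le> f a" if ar: "0 < a" "a < r" "r < 1" "r \<in> \<rat>" for a r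
  proof (rule ccontr)
    assume "\<not> f r \<le> f a"
    then have "f a < f r" by simp
    then have "eventually (\<lambda>s. f s < f r) (at_right a)"
      using cont_at[of a] that
      by (intro order_tendstoD(2)[OF tendsto_within_subset]) (auto simp: isCont_def)
    then obtain d where d: "d > a" "\<And>s. s > a \<Longrightarrow> s < d \<Longrightarrow> f s < f r"
      by (auto simp: eventually_at_right_field)
    obtain s where s: "s \<in> \<rat>" "a < s" "s < min d r"
      using Rats_dense_in_real[of a "min d r"] d(1) ar by auto
    with rat[of r s] d(2)[of s] ar show False by auto
  qed
  have right: "f a \<le> f r" if ar: "0 < r" "r < a" "a < 1" "r \<in> \<rat>" for a r
  proof (rule ccontr)
    assume "\<not> f a \<le> f r"
    then have "f r < f a" by simp
    then have "eventually (\<lambda>s. f r < f s) (at_left a)"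
      using cont_at[of a] that
      by (intro order_tendstoD(1)[OF tendsto_within_subset]) (auto simp: isCont_def)
    then obtain d where d: "d < a" "\<And>s. s > d \<Longrightarrow> s < a \<Longrightarrow> f r < f s"
      by (auto simp: eventually_at_left_field)
    obtain s where s: "s \<in> \<rat>" "max d r < s" "s < a"
      using Rats_dense_in_real[of "max d r" a] d(1) ar by auto
    with rat[of s r] d(2)[of s] ar show False by auto
  qed
  fix a b :: real assume ab: "a \<in> {0<..<1}" "b \<in> {0<..<1}" "a < b"
  obtain r where r: "r \<in> \<rat>" "a < r" "r < b" using Rats_dense_in_real[OF ab(3)] by auto
  obtain s where s: "s \<in> \<rat>" "r < s" "s < b" using Rats_dense_in_real[OF r(3)] by auto
  have "f b \<le> f s" "f s < f r" "f r \<le> f a"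
    using left[of a r] right[of s b] rat[of s r] r s ab by auto
  then show "f b < f a" by simp
qed

subsection \<open>Moment functions of positive laws\<close>

text \<open>\<open>m u\<close> is the moment of order \<open>u\<close> of a positive random
  variable. The nonnegative integral states finiteness and value in one equation;
  \<open>0 \<le> m u\<close> is demanded because \<open>ennreal\<close> sends negative reals to 0.
  Real orders allow \<open>u\<close> to be rescaled by a fraction.\<close>

definition positive_moments :: "(real \<Rightarrow> real) \<Rightarrow> bool" where
  "positive_moments m \<longleftrightarrow> (\<exists>M. prob_space M \<and> sets M = sets borel \<and> (AE y in M. 0 < y) \<and>
     (\<forall>u\<ge>0. 0 \<le> m u \<and> (\<integral>\<^sup>+y. ennreal (y powr u) \<partial>M) = ennreal (m u)))"

lemma positive_momentsE:
  assumes "positive_moments m"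
  obtains M where "prob_space M" "sets M = sets borel" "AE y in M. 0 < y"
    "\<And>u. u \<ge> 0 \<Longrightarrow> 0 \<le> m u" "\<And>u. u \<ge> 0 \<Longrightarrow> (\<integral>\<^sup>+y. ennreal (y powr u) \<partial>M) = ennreal (m u)"
  using assms unfolding positive_moments_def by blast

lemma positive_moments_cong:
  assumes "positive_moments m" "\<And>u. u \<ge> 0 \<Longrightarrow> m u = m' u"
  shows "positive_moments m'"
  using assms unfolding positive_moments_def by simp

lemma positive_moments_density:
  fixes f :: "real \<Rightarrow> real"
  assumes [measurable]: "f \<in> borel_measurable borel"
    and f: "\<And>y. f y \<ge> 0" "\<And>y. y \<le> 0 \<Longrightarrow> f y = 0"
    and int: "\<And>u. u \<ge> 0 \<Longrightarrow> (\<integral>\<^sup>+y. ennreal (f y * y powr u) \<partial>lborel) = ennreal (m u)"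
    and m: "\<And>u. u \<ge> 0 \<Longrightarrow> m u \<ge> 0" "m 0 = 1"
  shows "positive_moments m"
  unfolding positive_moments_def
proof (intro exI[of _ "density lborel (\<lambda>y. ennreal (f y))"] conjI allI impI)
  have "(\<integral>\<^sup>+y. ennreal (f y) \<partial>lborel) = (\<integral>\<^sup>+y. ennreal (f y * y powr 0) \<partial>lborel)"
    \<comment> \<open>\<open>0 powr 0\<close> is 0, so at the origin the two integrands agree
      because \<open>f\<close> vanishes there.\<close>
    by (intro nn_integral_cong) (use f(2) in auto)
  then show "prob_space (density lborel (\<lambda>y. ennreal (f y)))"
    using int[of 0] m by (intro prob_spaceI) (simp add: emeasure_density)
  show "AE y in density lborel (\<lambda>y. ennreal (f y)). 0 < y"
    using f(2) by (subst AE_density) (auto intro!: AE_I2 simp: not_less intro: ccontr)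
  fix u :: real assume "0 \<le> u"
  then show "(\<integral>\<^sup>+y. ennreal (y powr u) \<partial>density lborel (\<lambda>y. ennreal (f y))) = ennreal (m u)"
    using f by (simp add: nn_integral_density ennreal_mult'[symmetric] int)
qed (use m in auto)

text \<open>The law is the gamma law of shape \<open>a\<close> and scale 1.\<close>

lemma positive_moments_gamma:
  assumes "a > 0"
  shows "positive_moments (\<lambda>u. Gamma (u + a) / Gamma a)"
proof (rule positive_moments_density)
  define f where "f = (\<lambda>t. indicator {0..} t * (t powr (a - 1) / exp t) / Gamma a)"
  show "f \<in> borel_measurable borel" unfolding f_def by measurable
  show "f y \<ge> 0" for y using assms by (simp add: f_def)
  show "f y = 0" if "y \<le> 0" for y using that by (cases "y = 0") (auto simp: f_def)
  fix u :: real assume u: "u \<ge> 0"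
  have "(\<integral>\<^sup>+y. ennreal (f y * y powr u) \<partial>lborel)
     = (\<integral>\<^sup>+y. ennreal (1 / Gamma a) * ennreal (indicator {0..} y * y powr (u + a - 1) / exp y) \<partial>lborel)"
    by (intro nn_integral_cong)
      (use assms in \<open>auto simp: f_def ennreal_mult'[symmetric] indicator_def powr_add powr_diff field_simps\<close>)
  also have "\<dots> = ennreal (1 / Gamma a) * ennreal (Gamma (u + a))"
    using u assms by (subst nn_integral_cmult) (auto simp: Gamma_conv_nn_integral_real)
  finally show "(\<integral>\<^sup>+y. ennreal (f y * y powr u) \<partial>lborel) = ennreal (Gamma (u + a) / Gamma a)"
    using u assms by (simp add: ennreal_mult'[symmetric])
  show "Gamma (u + a) / Gamma a \<ge> 0" using u assms by simp
qed (use assms Gamma_real_pos[of a] in \<open>simp del: Gamma_real_pos\<close>)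

text \<open>The law is the beta law with parameters \<open>a\<close> and \<open>b - a\<close>; the
  factor \<open>Gamma (b - a)\<close> cancels from the quotient of Beta values.\<close>

lemma positive_moments_beta:
  assumes "0 < a" "a < b"
  shows "positive_moments (\<lambda>u. (Gamma (u + a) / Gamma a) / (Gamma (u + b) / Gamma b))"
proof (rule positive_moments_density)
  define B where "B = Beta a (b - a)"
  have B: "B > 0" unfolding B_def Beta_def using assms by simp
  define f where "f = (\<lambda>t. indicator {0..1} t * (t powr (a - 1) * (1 - t) powr (b - a - 1)) / B)"
  show "f \<in> borel_measurable borel" unfolding f_def by measurable
  show "f y \<ge> 0" for y using B by (simp add: f_def)
  show "f y = 0" if "y \<le> 0" for y using that by (cases "y = 0") (auto simp: f_def)
  fix u :: real assume u: "u \<ge> 0"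
  have "(\<integral>\<^sup>+y. ennreal (f y * y powr u) \<partial>lborel)
     = (\<integral>\<^sup>+y. ennreal (1 / B) * ennreal (indicator {0..1} y * (y powr (u + a - 1) * (1 - y) powr (b - a - 1))) \<partial>lborel)"
    by (intro nn_integral_cong)
      (use B in \<open>auto simp: f_def ennreal_mult'[symmetric] indicator_def powr_add powr_diff field_simps\<close>)
  also have "\<dots> = ennreal (1 / B) * (\<integral>\<^sup>+y. ennreal (indicator {0..1} y * (y powr (u + a - 1) * (1 - y) powr (b - a - 1))) \<partial>lborel)"
    by (intro nn_integral_cmult) measurable
  also have "\<dots> = ennreal (1 / B) * ennreal (Beta (u + a) (b - a))"
    using nn_integral_has_integral_lebesgue[OF _ has_integral_Beta_real[of "u + a" "b - a"]] u assms by simp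
  also have "\<dots> = ennreal (Beta (u + a) (b - a) / B)"
    using B by (simp add: ennreal_mult'[symmetric])
  also have "Beta (u + a) (b - a) / B = (Gamma (u + a) / Gamma a) / (Gamma (u + b) / Gamma b)"
    using assms Gamma_real_pos[of "b - a"] less_irrefl by (force simp: Beta_def B_def simp del: Gamma_real_pos)
  finally show "(\<integral>\<^sup>+y. ennreal (f y * y powr u) \<partial>lborel) =
      ennreal ((Gamma (u + a) / Gamma a) / (Gamma (u + b) / Gamma b))" .
  show "(Gamma (u + a) / Gamma a) / (Gamma (u + b) / Gamma b) \<ge> 0" using u assms by simp
qed (use assms Gamma_real_pos[of a] Gamma_real_pos[of b] in \<open>simp del: Gamma_real_pos\<close>)

section \<open>Point masses, powers and products of laws\<close>

lemma positive_moments_powr: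
  assumes "c > 0"
  shows "positive_moments (\<lambda>u. c powr u)"
  unfolding positive_moments_def
  using assms by (intro exI[of _ "return borel c"])
    (auto simp: prob_space_return AE_return nn_integral_return)

lemma positive_moments_rescale:
  assumes "positive_moments m" "c > 0"
  shows "positive_moments (\<lambda>u. m (c * u))"
proof -
  obtain M where M: "prob_space M" "sets M = sets borel" "AE y in M. 0 < y"
    "\<And>u. u \<ge> 0 \<Longrightarrow> 0 \<le> m u" "\<And>u. u \<ge> 0 \<Longrightarrow> (\<integral>\<^sup>+y. ennreal (y powr u) \<partial>M) = ennreal (m u)"
    using positive_momentsE[OF assms(1)] by blast
  note [measurable_cong] = M(2)
  show ?thesis unfolding positive_moments_def
  proof (intro exI[of _ "distr M borel (\<lambda>y. y powr c)"] conjI allI impI)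
    show "prob_space (distr M borel (\<lambda>y. y powr c))"
      by (rule prob_space.prob_space_distr[OF M(1)]) measurable
    show "AE y in distr M borel (\<lambda>y. y powr c). 0 < y"
      using M(3) by (subst AE_distr_iff) (auto elim!: eventually_mono)
    fix u :: real assume "0 \<le> u"
    then show "0 \<le> m (c * u)" "(\<integral>\<^sup>+y. ennreal (y powr u) \<partial>distr M borel (\<lambda>y. y powr c)) = ennreal (m (c * u))"
      using M(4,5)[of "c * u"] assms(2) by (auto simp: nn_integral_distr powr_powr)
  qed auto
qed

text \<open>The witness is the law of the product of two independent variables.\<close>
lemma positive_moments_mult:
  assumes "positive_moments m" "positive_moments m'"
  shows "positive_moments (\<lambda>u. m u * m' u)"
proof -
  obtain M where M: "prob_space M" "sets M = sets borel" "AE y in M. 0 < y"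
    "\<And>u. u \<ge> 0 \<Longrightarrow> 0 \<le> m u" "\<And>u. u \<ge> 0 \<Longrightarrow> (\<integral>\<^sup>+y. ennreal (y powr u) \<partial>M) = ennreal (m u)"
    using positive_momentsE[OF assms(1)] by blast
  obtain N where N: "prob_space N" "sets N = sets borel" "AE y in N. 0 < y"
    "\<And>u. u \<ge> 0 \<Longrightarrow> 0 \<le> m' u" "\<And>u. u \<ge> 0 \<Longrightarrow> (\<integral>\<^sup>+y. ennreal (y powr u) \<partial>N) = ennreal (m' u)"
    using positive_momentsE[OF assms(2)] by blast
  note [measurable_cong] = M(2) N(2)
  interpret M: prob_space M by fact
  interpret N: prob_space N by fact
  interpret MN: pair_prob_space M N ..
  show ?thesis unfolding positive_moments_def
  proof (intro exI[of _ "distr (M \<Otimes>\<^sub>M N) borel (\<lambda>(y, z). y * z)"] conjI allI impI)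
    show "prob_space (distr (M \<Otimes>\<^sub>M N) borel (\<lambda>(y, z). y * z))"
      by (rule MN.P.prob_space_distr) measurable
    have "AE p in M \<Otimes>\<^sub>M N. 0 < fst p * snd p"
    proof (rule MN.AE_pair_measure)
      show "AE y in M. AE z in N. 0 < fst (y, z) * snd (y, z)"
        using M(3) by eventually_elim (use N(3) in eventually_elim, simp)
    qed measurable
    then show "AE y in distr (M \<Otimes>\<^sub>M N) borel (\<lambda>(y, z). y * z). 0 < y"
      by (subst AE_distr_iff) (auto simp: case_prod_beta)
    fix u :: real assume u: "0 \<le> u"
    show "0 \<le> m u * m' u" using M(4) N(4) u by simp
    have "(\<integral>\<^sup>+y. ennreal (y powr u) \<partial>distr (M \<Otimes>\<^sub>M N) borel (\<lambda>(y, z). y * z))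
       = (\<integral>\<^sup>+p. ennreal ((fst p * snd p) powr u) \<partial>(M \<Otimes>\<^sub>M N))"
      by (subst nn_integral_distr) (auto simp: case_prod_beta)
    also have "\<dots> = (\<integral>\<^sup>+y. \<integral>\<^sup>+z. ennreal ((y * z) powr u) \<partial>N \<partial>M)"
      by (subst N.nn_integral_fst[symmetric]) auto
    also have "\<dots> = (\<integral>\<^sup>+y. \<integral>\<^sup>+z. ennreal (y powr u) * ennreal (z powr u) \<partial>N \<partial>M)"
    proof (rule nn_integral_cong_AE, use M(3) in eventually_elim)
      fix y :: real assume "0 < y"
      show "(\<integral>\<^sup>+z. ennreal ((y * z) powr u) \<partial>N) = (\<integral>\<^sup>+z. ennreal (y powr u) * ennreal (z powr u) \<partial>N)"
        by (rule nn_integral_cong_AE, use N(3) in eventually_elim)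
          (use \<open>0 < y\<close> in \<open>simp add: powr_mult ennreal_mult'\<close>)
    qed
    also have "\<dots> = ennreal (m u * m' u)"
      using M(4,5)[OF u] N(4,5)[OF u] by (simp add: nn_integral_cmult nn_integral_multc ennreal_mult')
    finally show "(\<integral>\<^sup>+y. ennreal (y powr u) \<partial>distr (M \<Otimes>\<^sub>M N) borel (\<lambda>(y, z). y * z)) = ennreal (m u * m' u)" .
  qed auto
qed

lemma positive_moments_prod:
  assumes "finite A" "\<And>i. i \<in> A \<Longrightarrow> positive_moments (m i)"
  shows "positive_moments (\<lambda>u. \<Prod>i\<in>A. m i u)"
  using assms
proof (induction A rule: finite_induct)
  case empty
  have "positive_moments (\<lambda>u. 1 powr u)" by (rule positive_moments_powr) simp
  then show ?case by simp
next
  case (insert i A)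
  then show ?case using positive_moments_mult[of "m i"] by simp
qed

text \<open>The multiplication formula gives \<open>p\<close> factors above and \<open>r\<close>
  below. Since \<open>(1 + j) / p < (1 + j) / r\<close>, the first \<open>r\<close> pairs are moment
  functions of beta laws; the remaining \<open>p - r\<close> factors belong to gamma laws.\<close>

lemma positive_moments_Gamma_ratio_nat:
  assumes "0 < r" "r < p"
  shows "positive_moments (\<lambda>u. Gamma (1 + real p * u) / Gamma (1 + real r * u))"
proof -
  define A where "A = (\<lambda>k j u. Gamma (u + (1 + real j) / real k) / Gamma ((1 + real j) / real k))"
  \<comment> \<open>The prefactors of the two multiplication formulas combine into
    \<open>c powr u\<close>, the moment function of a point mass.\<close>
  define c where "c = real p powr real p / real r powr real r"
  have "c > 0" using assms by (simp add: c_def)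
  have "positive_moments (A p j)" if "j \<in> {r..<p}" for j
    using positive_moments_gamma[of "(1 + real j) / real p"] assms by (simp add: A_def)
  moreover have "positive_moments (\<lambda>u. A p j u / A r j u)" if "j \<in> {..<r}" for j
    using positive_moments_beta[of "(1 + real j) / real p" "(1 + real j) / real r"] assms
    by (simp add: A_def frac_less2)
  ultimately have "positive_moments (\<lambda>u. c powr u * ((\<Prod>j<r. A p j u / A r j u) * (\<Prod>j\<in>{r..<p}. A p j u)))"
    using \<open>c > 0\<close> by (intro positive_moments_mult positive_moments_prod positive_moments_powr) auto
  then show ?thesis
  proof (rule positive_moments_cong)
    fix u :: real assume u: "u \<ge> 0"
    have "(\<Prod>j<p. A p j u) = (\<Prod>j<r. A p j u) * (\<Prod>j\<in>{r..<p}. A p j u)"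
      using assms by (subst prod.union_disjoint[symmetric]) (auto intro!: prod.cong)
    moreover have Gamma_A: "Gamma (1 + real k * u) = real k powr (real k * u) * (\<Prod>j<k. A k j u)" if "k > 0" for k
      using Gamma_multiplication[OF that u] by (simp add: A_def)
    moreover have "c powr u = real p powr (real p * u) / real r powr (real r * u)"
      using assms by (simp add: c_def powr_divide powr_powr)
    ultimately show "c powr u * ((\<Prod>j<r. A p j u / A r j u) * (\<Prod>j\<in>{r..<p}. A p j u))
        = Gamma (1 + real p * u) / Gamma (1 + real r * u)"
      using assms by (simp add: Gamma_A prod_dividef)
  qed
qed

text \<open>Over a common denominator, \<open>a = p s / (q s)\<close> and
  \<open>b = r q / (q s)\<close>, so the integer case applies after rescaling \<open>u\<close> by
  \<open>1 / (q s)\<close>.\<close>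

lemma positive_moments_Gamma_ratio:
  fixes a b :: real
  assumes "a \<in> \<rat>" "b \<in> \<rat>" "0 < b" "b < a"
  shows "positive_moments (\<lambda>u. Gamma (1 + a * u) / Gamma (1 + b * u))"
proof -
  obtain p q where pq: "q > 0" "a = real p / real q"
    using assms by (metis Rats_abs_nat_div_natE abs_of_pos less_trans of_nat_0_less_iff neq0_conv)
  obtain r s where rs: "s > 0" "b = real r / real s"
    using assms by (metis Rats_abs_nat_div_natE abs_of_pos of_nat_0_less_iff neq0_conv)
  have "real (r * q) < real (p * s)" "0 < r * q"
    using assms pq rs by (auto simp: field_simps)
  then have "positive_moments (\<lambda>u. Gamma (1 + real (p * s) * u) / Gamma (1 + real (r * q) * u))"
    by (intro positive_moments_Gamma_ratio_nat) (auto simp flip: of_nat_mult)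
  from positive_moments_rescale[OF this, of "1 / real (q * s)"]
  have "positive_moments (\<lambda>u. Gamma (1 + real (p * s) * (1 / real (q * s) * u)) / Gamma (1 + real (r * q) * (1 / real (q * s) * u)))"
    using pq rs by simp
  moreover have "real (p * s) * (1 / real (q * s) * u) = a * u" "real (r * q) * (1 / real (q * s) * u) = b * u" for u
    using pq rs by simp_all
  ultimately show ?thesis by simp
qed

section \<open>Integration of power series against a law\<close>

lemma has_bochner_integral_power_moments:
  assumes [measurable_cong]: "sets M = sets borel" and pos: "AE y in M. (0 :: real) < y"
    and mom: "\<And>u. u \<ge> 0 \<Longrightarrow> 0 \<le> m u" "\<And>u. u \<ge> 0 \<Longrightarrow> (\<integral>\<^sup>+y. ennreal (y powr u) \<partial>M) = ennreal (m u)"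
  shows "has_bochner_integral M (\<lambda>y. y ^ n) (m (real n))"
proof (rule has_bochner_integral_nn_integral)
  show "AE y in M. 0 \<le> y ^ n" using pos by eventually_elim simp
  have "(\<integral>\<^sup>+y. ennreal (y ^ n) \<partial>M) = (\<integral>\<^sup>+y. ennreal (y powr real n) \<partial>M)"
    by (rule nn_integral_cong_AE, use pos in eventually_elim) (simp add: powr_realpow)
  then show "(\<integral>\<^sup>+y. ennreal (y ^ n) \<partial>M) = ennreal (m (real n))" using mom by simp
qed (use mom in auto)

text \<open>The integrals of the absolute values of the terms form the same series at
  \<open>\<bar>t\<bar>\<close>, so summability at every argument permits termwise integration. The
  choice \<open>d n = 1 / fact n\<close> yields a moment generating function;
  \<open>d n = 1 / Gamma (1 + n * a)\<close> writes \<open>mittag_leffler b\<close> as an average of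
  \<open>mittag_leffler a\<close>.\<close>

lemma integral_power_series_moments:
  fixes d :: "nat \<Rightarrow> real"
  assumes "prob_space M" and [measurable_cong]: "sets M = sets borel" and pos: "AE y in M. 0 < y"
    and mom: "\<And>u. u \<ge> 0 \<Longrightarrow> 0 \<le> m u" "\<And>u. u \<ge> 0 \<Longrightarrow> (\<integral>\<^sup>+y. ennreal (y powr u) \<partial>M) = ennreal (m u)"
    and d: "\<And>n. d n \<ge> 0" "\<And>y. summable (\<lambda>n. d n * y ^ n)"
    and summ: "\<And>t. summable (\<lambda>n. d n * m (real n) * t ^ n)"
  shows "has_bochner_integral M (\<lambda>y. \<Sum>n. d n * (t * y) ^ n) (\<Sum>n. d n * m (real n) * t ^ n)"
proof -
  note hb = has_bochner_integral_power_moments[OF assms(2) pos mom]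
  define f where "f = (\<lambda>n y. d n * t ^ n * y ^ n)"
  have f: "has_bochner_integral M (f n) (d n * t ^ n * m (real n))" for n
    unfolding f_def by (intro has_bochner_integral_mult_right hb)
  have "(\<integral>y. norm (f n y) \<partial>M) = d n * \<bar>t\<bar> ^ n * m (real n)" for n
  proof -
    have "(\<integral>y. norm (f n y) \<partial>M) = (\<integral>y. d n * \<bar>t\<bar> ^ n * y ^ n \<partial>M)"
      unfolding f_def by (rule integral_cong_AE, measurable, use pos in eventually_elim)
        (simp add: abs_mult power_abs d)
    also have "\<dots> = d n * \<bar>t\<bar> ^ n * m (real n)"
      using hb[of n] by (simp add: has_bochner_integral_iff)
    finally show ?thesis .
  qed
  then have s: "summable (\<lambda>n. \<integral>y. norm (f n y) \<partial>M)"
    using summ[of "\<bar>t\<bar>"] by (simp add: mult_ac)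
  have i: "integrable M (f n)" for n using f by (simp add: has_bochner_integral_iff)
  have ae: "AE y in M. summable (\<lambda>n. norm (f n y))"
    using d(2)[of "\<bar>t * y\<bar>" for y]
    by (intro AE_I2) (simp add: f_def abs_mult power_abs d power_mult_distrib mult_ac)
  have "integrable M (\<lambda>y. \<Sum>n. f n y)" by (rule integrable_suminf[OF i ae s])
  moreover have "(\<integral>y. (\<Sum>n. f n y) \<partial>M) = (\<Sum>n. \<integral>y. f n y \<partial>M)" by (rule integral_suminf[OF i ae s])
  moreover have "(\<integral>y. f n y \<partial>M) = d n * m (real n) * t ^ n" for n
    using f[of n] by (simp add: has_bochner_integral_iff mult_ac)
  moreover have "f = (\<lambda>n y. d n * (t * y) ^ n)" by (simp add: f_def power_mult_distrib mult_ac)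
  ultimately show ?thesis by (simp only: has_bochner_integral_iff simp_thms)
qed

subsection \<open>Strict convexity and monotonicity\<close>

text \<open>Squaring the weak bound at \<open>w / 2\<close> gains the term \<open>w ^ 2 / 4\<close>,
  which makes it strict.\<close>

lemma exp_gt_one_plus:
  fixes w :: real
  assumes "w \<noteq> 0"
  shows "1 + w < exp w"
proof (cases "1 + w / 2 \<ge> 0")
  case True
  have "0 < w ^ 2" using assms by simp
  then have "1 + w < (1 + w / 2) ^ 2" by (simp add: power2_eq_square algebra_simps)
  also have "\<dots> \<le> exp (w / 2) ^ 2"
    using True exp_ge_add_one_self[of "w / 2"] by (intro power_mono) auto
  also have "\<dots> = exp w" by (simp flip: exp_double)
  finally show ?thesis .
next
  case False
  then have "1 + w < 0" by simp
  then show ?thesis using exp_gt_zero[of w] by linarith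
qed

text \<open>Strict convexity: \<open>mittag_leffler a\<close> is the moment generating function of the law whose
  \<open>n\<close>-th moment is \<open>n! / Gamma (1 + n a)\<close>, so the tangent inequality is inherited from \<open>exp\<close>.\<close>
lemma mittag_leffler_tangent:
  fixes a t0 :: real
  assumes "a \<in> \<rat>" "0 < a" "a < 1"
  obtains D where "\<And>t. t \<noteq> t0 \<Longrightarrow> mittag_leffler a t > mittag_leffler a t0 + D * (t - t0)"
proof -
  have "positive_moments (\<lambda>u. Gamma (1 + 1 * u) / Gamma (1 + a * u))"
    using assms by (intro positive_moments_Gamma_ratio) auto
  then obtain M where M: "prob_space M" "sets M = sets borel" "AE y in M. 0 < y"
    "\<And>u. u \<ge> 0 \<Longrightarrow> 0 \<le> Gamma (1 + 1 * u) / Gamma (1 + a * u)"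
    "\<And>u. u \<ge> 0 \<Longrightarrow> (\<integral>\<^sup>+y. ennreal (y powr u) \<partial>M) = ennreal (Gamma (1 + 1 * u) / Gamma (1 + a * u))"
    using positive_momentsE by blast
  interpret M: prob_space M by fact
  note [measurable_cong] = M(2)
  have fact: "Gamma (1 + real n) = fact n" for n using Gamma_fact[of n, where ?'a = real] by simp
  have "has_bochner_integral M (\<lambda>y. \<Sum>n. (1 / fact n) * (t * y) ^ n)
     (\<Sum>n. (1 / fact n) * (Gamma (1 + 1 * real n) / Gamma (1 + a * real n)) * t ^ n)" for t
  proof (rule integral_power_series_moments[OF M])
    show "summable (\<lambda>n. 1 / fact n * y ^ n)" for y :: real
      using summable_exp_generic[of y] by (simp add: field_simps)
    show "summable (\<lambda>n. 1 / fact n * (Gamma (1 + 1 * real n) / Gamma (1 + a * real n)) * t ^ n)" for t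
      using summable_mittag_leffler[OF assms(2), of t] by (simp add: fact mult_ac)
  qed auto
  moreover have "(\<Sum>n. (1 / fact n) * (t * y) ^ n) = exp (t * y)" for t y :: real
    by (simp add: exp_def field_simps)
  ultimately have E: "has_bochner_integral M (\<lambda>y. exp (t * y)) (mittag_leffler a t)" for t
    by (simp add: fact mittag_leffler_def mult.commute[of a])
  \<comment> \<open>The slope is the derivative of the moment generating function at
    \<open>t0\<close>, taken under the integral. It is finite because \<open>y \<le> exp y\<close>
    bounds the integrand by \<open>exp ((t0 + 1) * y)\<close>.\<close>
  define D where "D = (\<integral>y. y * exp (t0 * y) \<partial>M)"
  have "integrable M (\<lambda>y. y * exp (t0 * y))"
  proof (rule Bochner_Integration.integrable_bound)
    show "integrable M (\<lambda>y. exp ((t0 + 1) * y))" using E by (simp add: has_bochner_integral_iff)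
    show "AE y in M. norm (y * exp (t0 * y)) \<le> norm (exp ((t0 + 1) * y))"
      using M(3)
    proof eventually_elim
      fix y :: real assume "0 < y"
      have "y \<le> exp y" using exp_ge_add_one_self[of y] by linarith
      then show "norm (y * exp (t0 * y)) \<le> norm (exp ((t0 + 1) * y))"
        using \<open>0 < y\<close> by (simp add: distrib_right exp_add)
    qed
  qed measurable
  then have D: "has_bochner_integral M (\<lambda>y. y * exp (t0 * y)) D"
    by (simp add: D_def has_bochner_integral_iff)
  show thesis
  proof (rule that[of D])
    fix t assume "t \<noteq> t0"
    have L: "has_bochner_integral M (\<lambda>y. exp (t0 * y) + (y * exp (t0 * y)) * (t - t0))
        (mittag_leffler a t0 + D * (t - t0))"
      by (intro has_bochner_integral_add has_bochner_integral_mult_left E D)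
    have "(\<integral>y. exp (t0 * y) + (y * exp (t0 * y)) * (t - t0) \<partial>M) < (\<integral>y. exp (t * y) \<partial>M)"
    proof (rule M.integral_less_AE_space)
      show "AE y in M. exp (t0 * y) + (y * exp (t0 * y)) * (t - t0) < exp (t * y)"
        using M(3)
      proof eventually_elim
        fix y :: real assume "0 < y"
        then have "(t - t0) * y \<noteq> 0" using \<open>t \<noteq> t0\<close> by simp
        then have "1 + (t - t0) * y < exp ((t - t0) * y)" by (rule exp_gt_one_plus)
        then have "exp (t0 * y) * (1 + (t - t0) * y) < exp (t0 * y) * exp ((t - t0) * y)" by simp
        then show "exp (t0 * y) + (y * exp (t0 * y)) * (t - t0) < exp (t * y)"
          by (simp add: exp_add[symmetric] algebra_simps)
      qed
    qed (use L E M.emeasure_space_1 in \<open>auto simp: has_bochner_integral_iff\<close>)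
    then show "mittag_leffler a t0 + D * (t - t0) < mittag_leffler a t"
      using L E[of t] by (simp add: has_bochner_integral_iff)
  qed
qed

text \<open>Jensen's inequality through the tangent at the mean: the gap \<open>h\<close> is
  nonnegative and integrates to the difference of the two values. A zero integral would make the
  mixing variable constant, contradicting its positive variance.\<close>

lemma mittag_leffler_less_rat:
  fixes a b x :: real
  assumes "x \<noteq> 0" "a \<in> \<rat>" "b \<in> \<rat>" "0 < b" "b < a" "a < 1"
  shows "mittag_leffler a (Gamma (1 + a) * x) < mittag_leffler b (Gamma (1 + b) * x)"
proof -
  define m where "m = (\<lambda>u. Gamma (1 + a * u) / Gamma (1 + b * u))"
  have "positive_moments m" unfolding m_def
    using assms by (intro positive_moments_Gamma_ratio) auto
  then obtain M where M: "prob_space M" "sets M = sets borel" "AE y in M. 0 < y"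
    "\<And>u. u \<ge> 0 \<Longrightarrow> 0 \<le> m u" "\<And>u. u \<ge> 0 \<Longrightarrow> (\<integral>\<^sup>+y. ennreal (y powr u) \<partial>M) = ennreal (m u)"
    using positive_momentsE by blast
  interpret M: prob_space M by fact
  note [measurable_cong] = M(2)
  have Gpos: "Gamma (1 + c * real n) > 0" if "c > 0" for c n
    using that by (intro Gamma_real_pos add_pos_nonneg) auto
  define s where "s = Gamma (1 + b) * x"
  define t0 where "t0 = Gamma (1 + a) * x"
  have Gb: "Gamma (1 + b) \<noteq> 0" using assms by (intro less_imp_neq[THEN not_sym] Gamma_real_pos) auto
  \<comment> \<open>The tangent point \<open>t0\<close> is the mean of \<open>s * y\<close>, so the
    linear term of the tangent integrates to 0.\<close>
  have st0: "s * m 1 = t0" using Gb by (simp add: s_def t0_def m_def)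
  have "has_bochner_integral M (\<lambda>y. \<Sum>n. (1 / Gamma (1 + real n * a)) * (s * y) ^ n)
      (\<Sum>n. (1 / Gamma (1 + real n * a)) * m (real n) * s ^ n)"
  proof (rule integral_power_series_moments[OF M])
    show "summable (\<lambda>n. 1 / Gamma (1 + real n * a) * y ^ n)" for y
      using summable_mittag_leffler[of a y] assms by simp
    have "1 / Gamma (1 + real n * a) * m (real n) * t ^ n = t ^ n / Gamma (1 + real n * b)" for n t
      using Gpos[of a n] assms by (simp add: m_def mult_ac)
    then show "summable (\<lambda>n. 1 / Gamma (1 + real n * a) * m (real n) * t ^ n)" for t
      using summable_mittag_leffler[of b t] assms by simp
  qed (use Gpos[of a] assms in \<open>auto simp: mult_ac less_imp_le\<close>)
  moreover have "1 / Gamma (1 + real n * a) * m (real n) * s ^ n = s ^ n / Gamma (1 + real n * b)" for n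
    using Gpos[of a n] assms by (simp add: m_def mult_ac)
  ultimately have F: "has_bochner_integral M (\<lambda>y. mittag_leffler a (s * y)) (mittag_leffler b s)"
    by (simp add: mittag_leffler_def)
  note pw = has_bochner_integral_power_moments[OF M(2-5)]
  obtain D where D: "\<And>t. t \<noteq> t0 \<Longrightarrow> mittag_leffler a t > mittag_leffler a t0 + D * (t - t0)"
    using mittag_leffler_tangent[of a t0] assms by auto
  define h where "h = (\<lambda>y. mittag_leffler a (s * y) - (mittag_leffler a t0 + D * (s * y - t0)))"
  have h_nonneg: "h y \<ge> 0" and h_zero: "h y = 0 \<Longrightarrow> s * y = t0" for y
    using D[of "s * y"] by (cases "s * y = t0"; simp add: h_def)+
  have "has_bochner_integral M h (mittag_leffler b s - (mittag_leffler a t0 + D * (s * m 1 - t0)))"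
    unfolding h_def
  proof (intro has_bochner_integral_diff has_bochner_integral_add has_bochner_integral_mult_right F)
    have c: "has_bochner_integral M (\<lambda>_. c) c" for c :: real
      by (simp add: has_bochner_integral_iff M.prob_space)
    show "has_bochner_integral M (\<lambda>_. mittag_leffler a t0) (mittag_leffler a t0)"
      "has_bochner_integral M (\<lambda>_. t0) t0" by (rule c)+
    show "has_bochner_integral M (\<lambda>y. y) (m 1)" using pw[of 1] by simp
  qed
  then have H: "has_bochner_integral M h (mittag_leffler b s - mittag_leffler a t0)"
    using st0 by simp
  moreover have "integral\<^sup>L M h \<noteq> 0"
  proof
    assume "integral\<^sup>L M h = 0"
    then have "AE y in M. h y = 0"
      using H h_nonneg by (subst (asm) integral_nonneg_eq_0_iff_AE) (auto simp: has_bochner_integral_iff)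
    then have "AE y in M. y = m 1"
    proof eventually_elim
      fix y assume "h y = 0"
      then have "s * y = s * m 1" using h_zero st0 by simp
      then show "y = m 1" using assms Gb by (simp add: s_def)
    qed
    \<comment> \<open>A constant variable satisfies \<open>m 2 = (m 1) ^ 2\<close>, whereas
      \<open>Gamma_ratio_less\<close> with \<open>n = 2\<close> amounts to
      \<open>(m 1) ^ 2 < m 2\<close>.\<close>
    then have "(\<integral>y. y ^ 2 \<partial>M) = (\<integral>y. (m 1) ^ 2 \<partial>M)"
      by (intro integral_cong_AE) (auto elim!: eventually_mono)
    then have "m 2 = (m 1) ^ 2" using pw[of 2] M.prob_space by (simp add: has_bochner_integral_iff)
    moreover have "Gamma (1 + a) ^ 2 / Gamma (1 + 2 * a) < Gamma (1 + b) ^ 2 / Gamma (1 + 2 * b)"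
      using Gamma_ratio_less[of 2 b a] assms by simp
    moreover have False if "p / q = (r / s) ^ 2" "r ^ 2 / p < s ^ 2 / q" "p > 0" "q > 0" "s > 0" for p q r s :: real
      using that by (simp add: field_simps power_divide)
    note this[of "Gamma (1 + 2 * a)" "Gamma (1 + 2 * b)" "Gamma (1 + a)" "Gamma (1 + b)"]
    ultimately show False
      using assms by (simp add: m_def mult.commute)
  qed
  moreover have "integral\<^sup>L M h \<ge> 0" using h_nonneg by (simp add: integral_nonneg_AE)
  ultimately show ?thesis by (simp add: has_bochner_integral_iff s_def t0_def)
qed

theorem theoremC:
  fixes x :: real
  assumes "x \<noteq> 0"
  shows "strict_antimono_on {0<..<1} (\<lambda>\<alpha>. mittag_leffler \<alpha> (Gamma (1 + \<alpha>) * x))"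
  using continuous_on_mittag_leffler_Gamma mittag_leffler_less_rat[OF assms]
  by (rule strict_antimono_on_from_Rats)

end
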